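(* Let $\mathcal{E}_S=(\mathcal{X},\Theta,\{P^S_\theta\}_{\theta\in\Theta})$ and $\mathcal{E}_T=(\mathcal{X},\Theta,\{P^T_\theta\}_{\theta\in\Theta})$ be two statistical experiments (source and target) over the same parameter space $\Theta$ and on a common sample space $\mathcal{X}$. Let $T:\mathcal{X}\rightsquigarrow\mathcal{Z}$ be a representation map (possibly randomized, i.e. a Markov kernel), and let $Q^S_\theta = P^S_\theta T$ and $Q^T_\theta = P^T_\theta T$ be the induced distributions on $\mathcal{Z}$. Then there exists a constant $C>0$ such that $$\delta(\mathcal{E}_S\circ T,\mathcal{E}_S)+\delta(\mathcal{E}_T\circ T,\mathcal{E}_T)+\sup_{\theta\in\Theta}\|Q^S_\theta-Q^T_\theta\|_{TV}\ \ge\ C\cdot\delta(\mathcal{E}_T,\mathcal{E}_S).$$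
   Context: A statistical experiment is a triple $(\mathcal{X},\Theta,\{P_\theta\}_{\theta\in\Theta})$ of a measurable sample space $\mathcal{X}$, a parameter set $\Theta$ and probability measures $P_\theta$ on $\mathcal{X}$. The superscripts/subscripts $S$ and $T$ on $\mathcal{E}$, $P_\theta$, $Q_\theta$ stand for "source" and "target" and are unrelated to the map $T$. A Markov kernel $K:\mathcal{X}\rightsquigarrow\mathcal{Y}$ assigns (measurably) to each $x\in\mathcal{X}$ a probability measure $K(x,\cdot)$ on $\mathcal{Y}$; $P_\theta K$ denotes the measure $B\mapsto\int K(x,B)\,P_\theta(dx)$, and for an experiment $\mathcal{E}$ with distributions $P_\theta$, $\mathcal{E}\circ K$ denotes the experiment with the same parameter space and distributions $P_\theta K$ on $\mathcal{Y}$. For experiments $\mathcal{E}=(\mathcal{X},\Theta,\{P_\theta\})$ and $\mathcal{F}=(\mathcal{Y},\Theta,\{Q_\theta\})$, the (Le Cam) deficiency is $$\delta(\mathcal{E},\mathcal{F})=\inf_K\sup_{\theta\in\Theta}\|P_\theta K-Q_\theta\|_{TV},$$ the infimum being over all Markov kernels $K:\mathcal{X}\rightsquigarrow\mathcal{Y}$, where $\|P-Q\|_{TV}=\sup_B|P(B)-Q(B)|$. *)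

theory Defs
  imports "HOL-Probability.Probability"
begin

text \<open>
  As usual in the library, a measurable space is represented by a measure whose values are
  irrelevant: of \<open>sample_space\<close> only the underlying \<open>\<sigma>\<close>-algebra matters. Markov kernels from
  \<open>X\<close> to \<open>Y\<close> are the elements of \<open>X \<rightarrow>\<^sub>M prob_algebra Y\<close>, and \<open>PK\<close> is the Giry bind
  \<open>bind P K\<close>.
\<close>

record ('x, 't) stat_exp =
  sample_space :: "'x measure"
  param_set :: "'t set"
  law :: "'t \<Rightarrow> 'x measure"

definition statistical_experiment :: "('x, 't) stat_exp \<Rightarrow> bool" where
  "statistical_experiment E \<longleftrightarrow>
     (\<forall>\<theta>\<in>param_set E. prob_space (law E \<theta>) \<and> sets (law E \<theta>) = sets (sample_space E))"

text \<open>The codomain \<open>Z\<close> has to be given, since a function \<open>K\<close> does not determine it.\<close>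

definition experiment_comp ::
  "('x, 't) stat_exp \<Rightarrow> 'z measure \<Rightarrow> ('x \<Rightarrow> 'z measure) \<Rightarrow> ('z, 't) stat_exp" where
  "experiment_comp E Z K =
     \<lparr> sample_space = Z, param_set = param_set E, law = (\<lambda>\<theta>. bind (law E \<theta>) K) \<rparr>"

text \<open>Intended for probability measures \<open>P\<close>, \<open>Q\<close> with the same \<open>\<sigma>\<close>-algebra.\<close>

definition tv_dist :: "'a measure \<Rightarrow> 'a measure \<Rightarrow> real" where
  "tv_dist P Q = (SUP B\<in>sets P. \<bar>measure P B - measure Q B\<bar>)"

text \<open>
  Intended for experiments with the same parameter set. The value lies in \<open>ennreal\<close>, so that
  the supremum over an empty parameter set is \<open>0\<close> and an infimum over no kernels is \<open>\<infinity>\<close>.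
\<close>

definition deficiency :: "('x, 't) stat_exp \<Rightarrow> ('y, 't) stat_exp \<Rightarrow> ennreal" where
  "deficiency E F =
     (INF K \<in> sample_space E \<rightarrow>\<^sub>M prob_algebra (sample_space F).
        SUP \<theta>\<in>param_set E. ennreal (tv_dist (bind (law E \<theta>) K) (law F \<theta>)))"

end

theory Submission
  imports Defs
begin

text \<open>
  The inequality holds with \<open>C = 1\<close>. A kernel \<open>K\<close> that reconstructs the source experiment from
  its representation gives the kernel \<open>TK\<close> from the target to the source, and
  \<open>\<parallel>P\<^sup>T T K - P\<^sup>S\<parallel> \<le> \<parallel>P\<^sup>T T K - P\<^sup>S T K\<parallel> + \<parallel>P\<^sup>S T K - P\<^sup>S\<parallel>\<close>, where the first summand is at most
  \<open>\<parallel>P\<^sup>T T - P\<^sup>S T\<parallel>\<close> because kernels contract total variation. The contraction is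
  the bound \<open>\<integral>f dP - \<integral>f dQ \<le> P(A) - Q(A)\<close> for \<open>0 \<le> f \<le> 1\<close> and a Hahn set \<open>A\<close> of \<open>P - Q\<close>.
\<close>

section \<open>Elementary properties of the total variation distance\<close>

lemma bdd_above_tv:
  assumes "prob_space P" "prob_space Q"
  shows "bdd_above ((\<lambda>B. \<bar>measure P B - measure Q B\<bar>) ` S)"
proof (rule bdd_aboveI2[where M = 1])
  fix B
  show "\<bar>measure P B - measure Q B\<bar> \<le> 1"
    using prob_space.prob_le_1[OF assms(1), of B] prob_space.prob_le_1[OF assms(2), of B]
      measure_nonneg[of P B] measure_nonneg[of Q B]
    by linarith
qed

lemma tv_dist_upper:
  assumes "prob_space P" "prob_space Q" "B \<in> sets P"
  shows "\<bar>measure P B - measure Q B\<bar> \<le> tv_dist P Q"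
  unfolding tv_dist_def by (rule cSUP_upper[OF assms(3) bdd_above_tv[OF assms(1,2)]])

lemma tv_dist_least:
  assumes "\<And>B. B \<in> sets P \<Longrightarrow> \<bar>measure P B - measure Q B\<bar> \<le> c"
  shows "tv_dist P Q \<le> c"
  unfolding tv_dist_def using assms by (intro cSUP_least) auto

lemma tv_dist_nonneg:
  assumes "prob_space P" "prob_space Q"
  shows "0 \<le> tv_dist P Q"
  using tv_dist_upper[OF assms sets.empty_sets] by simp

lemma tv_dist_commute:
  assumes "sets P = sets Q"
  shows "tv_dist P Q = tv_dist Q P"
  unfolding tv_dist_def using assms by (simp add: abs_minus_commute)

lemma tv_dist_triangle:
  assumes "prob_space P" "prob_space Q" "prob_space R" "sets P = sets Q"
  shows "tv_dist P R \<le> tv_dist P Q + tv_dist Q R"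
proof (rule tv_dist_least)
  fix B assume "B \<in> sets P"
  then show "\<bar>measure P B - measure R B\<bar> \<le> tv_dist P Q + tv_dist Q R"
    using tv_dist_upper[of P Q B] tv_dist_upper[of Q R B] assms by simp
qed

section \<open>Comparison of integrals and contraction under kernels\<close>

text \<open>Giving both measures the density \<open>indicator A\<close> turns domination on the
  subsets of \<open>A\<close> into domination on all sets, and the nonnegative integral is monotone
  in the measure. Integrability carries the inequality over to real integrals.\<close>

lemma integral_mono_measure_on:
  fixes h :: "'a \<Rightarrow> real"
  assumes sets: "sets N = sets M" and A: "A \<in> sets M"
    and le: "\<And>X. X \<in> sets M \<Longrightarrow> X \<subseteq> A \<Longrightarrow> emeasure N X \<le> emeasure M X"
    and h: "integrable M h" "integrable N h" "\<And>x. x \<in> space M \<Longrightarrow> 0 \<le> h x"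
  shows "(\<integral>x. indicator A x * h x \<partial>N) \<le> (\<integral>x. indicator A x * h x \<partial>M)"
proof -
  have sp: "space N = space M" by (rule sets_eq_imp_space_eq[OF sets])
  have h_meas: "h \<in> borel_measurable M" "h \<in> borel_measurable N" using h by auto
  have A': "A \<in> sets N" using A sets by simp
  have split: "(\<integral>\<^sup>+x. ennreal (indicator A x * h x) \<partial>L)
      = (\<integral>\<^sup>+x. ennreal (h x) \<partial>density L (indicator A))"
    if "A \<in> sets L" "h \<in> borel_measurable L" for L
    using that by (subst nn_integral_density) (auto intro!: nn_integral_cong split: split_indicator)
  have dens: "density N (indicator A) \<le> density M (indicator A)"
  proof -
    \<comment> \<open>The order on measures with equal sigma-algebras compares
      \<open>emeasure\<close> on all sets, so \<open>X\<close> is arbitrary here; outside the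
      sigma-algebra both sides are 0.\<close>
    have "emeasure (density N (indicator A)) X \<le> emeasure (density M (indicator A)) X" for X
    proof (cases "X \<in> sets M")
      case True
      then have "A \<inter> X \<in> sets M" using A by auto
      then show ?thesis using True A A' sets le[of "A \<inter> X"]
        by (simp add: emeasure_density indicator_inter_arith[symmetric])
    qed (simp add: emeasure_notin_sets sets)
    then show ?thesis by (simp add: le_measure_iff le_fun_def sets sp)
  qed
  have nn: "(\<integral>\<^sup>+x. ennreal (indicator A x * h x) \<partial>N) \<le> (\<integral>\<^sup>+x. ennreal (indicator A x * h x) \<partial>M)"
    unfolding split[OF A h_meas(1)] split[OF A' h_meas(2)]
    by (rule nn_integral_mono_measure) (simp_all add: sets dens)
  have int: "integrable M (\<lambda>x. indicator A x * h x)" "integrable N (\<lambda>x. indicator A x * h x)"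
    using integrable_mult_indicator[OF A h(1)] integrable_mult_indicator[OF A' h(2)]
    by simp_all
  have nonneg: "AE x in M. 0 \<le> indicator A x * h x" "AE x in N. 0 \<le> indicator A x * h x"
    using h(3) sp by auto
  have "ennreal (\<integral>x. indicator A x * h x \<partial>N) \<le> ennreal (\<integral>x. indicator A x * h x \<partial>M)"
    using nn unfolding nn_integral_eq_integral[OF int(1) nonneg(1)]
      nn_integral_eq_integral[OF int(2) nonneg(2)] .
  moreover have "0 \<le> (\<integral>x. indicator A x * h x \<partial>M)"
    by (rule integral_nonneg_AE[OF nonneg(1)])
  ultimately show ?thesis by simp
qed

text \<open>Raising \<open>f\<close> to 1 on the Hahn set \<open>A\<close>, where \<open>P\<close>
  dominates, and lowering it to 0 on the complement \<open>B\<close>, where \<open>Q\<close>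
  dominates, can only increase the difference of the integrals. The result is the integrand
  \<open>indicator A\<close>, which gives \<open>P(A) - Q(A)\<close>.\<close>

lemma integral_diff_le_tv_dist:
  fixes f :: "'a \<Rightarrow> real"
  assumes P: "prob_space P" and Q: "prob_space Q" and sets: "sets P = sets Q"
    and f: "f \<in> borel_measurable P" "\<And>x. x \<in> space P \<Longrightarrow> 0 \<le> f x" "\<And>x. x \<in> space P \<Longrightarrow> f x \<le> 1"
  shows "(\<integral>x. f x \<partial>P) - (\<integral>x. f x \<partial>Q) \<le> tv_dist P Q"
proof -
  interpret P: prob_space P by fact
  interpret Q: prob_space Q by fact
  have sp: "space Q = space P" by (rule sets_eq_imp_space_eq[OF sets[symmetric]])
  obtain A where A: "A \<in> sets P"
    and QP: "\<And>X. X \<in> sets P \<Longrightarrow> X \<subseteq> A \<Longrightarrow> emeasure Q X \<le> emeasure P X"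
    and PQ: "\<And>X. X \<in> sets P \<Longrightarrow> X \<inter> A = {} \<Longrightarrow> emeasure P X \<le> emeasure Q X"
    using finite_unsigned_Hahn_decomposition[OF P.finite_measure_axioms Q.finite_measure_axioms]
      sets by metis
  define B where "B = space P - A"
  have AQ: "A \<in> sets Q" and B: "B \<in> sets P" "B \<in> sets Q"
    using A sets by (auto simp: B_def)
  have fQ: "f \<in> borel_measurable Q"
    using f(1) measurable_cong_sets[OF sets refl] by auto
  have int: "integrable P f" "integrable Q f"
    using f fQ sp
    by (auto intro!: P.integrable_const_bound[where B=1] Q.integrable_const_bound[where B=1])
  have 1: "(\<integral>x. indicator A x * (1 - f x) \<partial>Q) \<le> (\<integral>x. indicator A x * (1 - f x) \<partial>P)"
    by (rule integral_mono_measure_on) (use sets A QP int f(3) in auto)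
  have 2: "(\<integral>x. indicator B x * f x \<partial>P) \<le> (\<integral>x. indicator B x * f x \<partial>Q)"
  proof (rule integral_mono_measure_on)
    fix X assume "X \<in> sets Q" "X \<subseteq> B"
    then show "emeasure P X \<le> emeasure Q X" by (intro PQ) (auto simp: sets B_def)
  qed (use sets B int f(2) sp in auto)
  \<comment> \<open>This integrates the pointwise identity
    \<open>f = 1_A - 1_A (1 - f) + 1_B f\<close>, chosen so that its correction terms are the
    integrals compared in \<open>1\<close> and \<open>2\<close>. It is stated for a generic
    \<open>L\<close> to serve both \<open>P\<close> and \<open>Q\<close>.\<close>
  have split: "(\<integral>x. f x \<partial>L) = measure L A - (\<integral>x. indicator A x * (1 - f x) \<partial>L) + (\<integral>x. indicator B x * f x \<partial>L)"
    if L: "prob_space L" "integrable L f" "A \<in> sets L" "B \<in> sets L" "space L = space P" for L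
  proof -
    interpret L: prob_space L by fact
    have i: "integrable L (\<lambda>x. indicator A x * (1 - f x))" "integrable L (\<lambda>x. indicator B x * f x)"
      using integrable_mult_indicator[OF L(3), of "\<lambda>x. 1 - f x"] integrable_mult_indicator[OF L(4,2)] L(2)
      by simp_all
    have iA: "integrable L (indicator A :: _ \<Rightarrow> real)"
      using L(3) by (simp add: less_top[symmetric])
    have "(\<integral>x. f x \<partial>L) = (\<integral>x. indicator A x - indicator A x * (1 - f x) + indicator B x * f x \<partial>L)"
      by (intro Bochner_Integration.integral_cong) (auto simp: B_def L(5) split: split_indicator)
    also have "\<dots> = measure L A - (\<integral>x. indicator A x * (1 - f x) \<partial>L) + (\<integral>x. indicator B x * f x \<partial>L)"
      using i iA L(3) sets.Int_space_eq2[OF L(3)]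
      by (subst Bochner_Integration.integral_add Bochner_Integration.integral_diff;
          (intro Bochner_Integration.integrable_diff)?; simp)+
    finally show ?thesis .
  qed
  have "(\<integral>x. f x \<partial>P) - (\<integral>x. f x \<partial>Q) \<le> measure P A - measure Q A"
    using 1 2 split[OF P int(1) A B(1)] split[OF Q int(2) AQ B(2) sp] by simp
  also have "\<dots> \<le> tv_dist P Q"
    using tv_dist_upper[OF P Q A] by linarith
  finally show ?thesis .
qed

text \<open>The mass that \<open>bind P K\<close> gives to \<open>B\<close> is the
  \<open>P\<close>-integral of \<open>measure (K x) B\<close>, a measurable function of
  \<open>x\<close> with values between 0 and 1, so the bound on differences of integrals
  applies.\<close>

lemma tv_dist_bind_le:
  assumes P: "P \<in> space (prob_algebra M)" and Q: "Q \<in> space (prob_algebra M)"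
    and K: "K \<in> M \<rightarrow>\<^sub>M prob_algebra N"
  shows "tv_dist (bind P K) (bind Q K) \<le> tv_dist P Q"
proof (rule tv_dist_least)
  have pP: "prob_space P" "sets P = sets M" and pQ: "prob_space Q" "sets Q = sets M"
    using P Q by (auto simp: space_prob_algebra)
  interpret P: prob_space P by fact
  interpret Q: prob_space Q by fact
  have sp: "space P = space M" using pP by (auto dest: sets_eq_imp_space_eq)
  fix B assume "B \<in> sets (bind P K)"
  then have B: "B \<in> sets N" using sets_bind'[OF P K] by simp
  have KM: "K \<in> M \<rightarrow>\<^sub>M subprob_algebra N" by (rule measurable_prob_algebraD[OF K])
  then have KP: "K \<in> P \<rightarrow>\<^sub>M subprob_algebra N" and KQ: "K \<in> Q \<rightarrow>\<^sub>M subprob_algebra N"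
    using measurable_cong_sets[OF pP(2) refl] measurable_cong_sets[OF pQ(2) refl] by auto
  have f: "(\<lambda>x. measure (K x) B) \<in> borel_measurable M"
    using measurable_compose[OF KM measurable_measure_subprob_algebra[OF B]] .
  have f': "(\<lambda>x. measure (K x) B) \<in> borel_measurable P" "(\<lambda>x. measure (K x) B) \<in> borel_measurable Q"
    using f measurable_cong_sets[OF pP(2) refl] measurable_cong_sets[OF pQ(2) refl] by auto
  have le1: "measure (K x) B \<le> 1" if "x \<in> space M" for x
    using measurable_space[OF K that] by (auto simp: space_prob_algebra prob_space.prob_le_1)
  have eq: "measure (bind P K) B = (\<integral>x. measure (K x) B \<partial>P)"
    "measure (bind Q K) B = (\<integral>x. measure (K x) B \<partial>Q)"
    using P.measure_bind[OF KP B] Q.measure_bind[OF KQ B] by auto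
  have "measure (bind P K) B - measure (bind Q K) B \<le> tv_dist P Q"
    unfolding eq using f' le1 sp pP pQ by (intro integral_diff_le_tv_dist) auto
  \<comment> \<open>The integral bound is one-sided; exchanging \<open>P\<close> and
    \<open>Q\<close> supplies the other half of the absolute value.\<close>
  moreover have "measure (bind Q K) B - measure (bind P K) B \<le> tv_dist Q P"
    unfolding eq using f' le1 sets_eq_imp_space_eq[OF pQ(2)] pP pQ
    by (intro integral_diff_le_tv_dist) auto
  ultimately show "\<bar>measure (bind P K) B - measure (bind Q K) B\<bar> \<le> tv_dist P Q"
    using tv_dist_commute[of P Q] pP pQ by auto
qed

section \<open>Deficiency bounds\<close>

lemma deficiency_le_representation:
  fixes ES ET :: "('x, 't) stat_exp" and T :: "'x \<Rightarrow> 'z measure"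
  assumes ES: "statistical_experiment ES" and ET: "statistical_experiment ET"
    and par: "param_set ES = param_set ET"
    and smp: "sets (sample_space ES) = sets (sample_space ET)"
    and T: "T \<in> sample_space ES \<rightarrow>\<^sub>M prob_algebra Z"
  shows "deficiency ET ES \<le> deficiency (experiment_comp ES Z T) ES
     + (SUP \<theta>\<in>param_set ES. ennreal (tv_dist (bind (law ES \<theta>) T) (bind (law ET \<theta>) T)))"
    (is "_ \<le> _ + ?s")
proof -
  let ?X = "sample_space ES"
  let ?g = "\<lambda>K. SUP \<theta>\<in>param_set ES. ennreal (tv_dist (bind (bind (law ES \<theta>) T) K) (law ES \<theta>))"
  have bound: "deficiency ET ES \<le> ?s + ?g K" if K: "K \<in> Z \<rightarrow>\<^sub>M prob_algebra ?X" for K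
  proof -
    \<comment> \<open>The composite kernel is the competitor in the infimum defining
      \<open>deficiency ET ES\<close>. Its measurability transfers from \<open>ES\<close> to
      \<open>ET\<close> because the two sample spaces share their measurable sets.\<close>
    have TK: "(\<lambda>x. bind (T x) K) \<in> sample_space ET \<rightarrow>\<^sub>M prob_algebra ?X"
      using measurable_bind_prob_space[OF T K] measurable_cong_sets[OF smp refl] by auto
    have "ennreal (tv_dist (bind (law ET \<theta>) (\<lambda>x. bind (T x) K)) (law ES \<theta>)) \<le> ?s + ?g K"
      if \<theta>: "\<theta> \<in> param_set ET" for \<theta>
    proof -
      let ?P = "law ES \<theta>" and ?Q = "law ET \<theta>"
      have P: "?P \<in> space (prob_algebra ?X)" and Q: "?Q \<in> space (prob_algebra ?X)"
        using ES ET \<theta> par smp by (auto simp: statistical_experiment_def space_prob_algebra)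
      have PT: "bind ?P T \<in> space (prob_algebra Z)" and QT: "bind ?Q T \<in> space (prob_algebra Z)"
        using prob_space_bind'[OF P T] sets_bind'[OF P T] prob_space_bind'[OF Q T] sets_bind'[OF Q T]
        by (auto simp: space_prob_algebra)
      have assoc: "bind ?Q (\<lambda>x. bind (T x) K) = bind (bind ?Q T) K"
      proof (rule bind_assoc[symmetric])
        show "T \<in> ?Q \<rightarrow>\<^sub>M subprob_algebra Z"
          using measurable_prob_algebraD[OF T] Q measurable_cong_sets[of ?Q ?X, OF _ refl]
          by (auto simp: space_prob_algebra)
        show "K \<in> Z \<rightarrow>\<^sub>M subprob_algebra ?X" by (rule measurable_prob_algebraD[OF K])
      qed
      note probs = prob_space_bind'[OF PT K] prob_space_bind'[OF QT K]
      have pP: "prob_space ?P" using P by (simp add: space_prob_algebra)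
      have "tv_dist (bind (bind ?Q T) K) ?P
          \<le> tv_dist (bind (bind ?Q T) K) (bind (bind ?P T) K) + tv_dist (bind (bind ?P T) K) ?P"
        using probs pP sets_bind'[OF PT K] sets_bind'[OF QT K] by (intro tv_dist_triangle) auto
      also have "tv_dist (bind (bind ?Q T) K) (bind (bind ?P T) K) \<le> tv_dist (bind ?Q T) (bind ?P T)"
        by (rule tv_dist_bind_le[OF QT PT K])
      also have "\<dots> = tv_dist (bind ?P T) (bind ?Q T)"
        using PT QT by (intro tv_dist_commute) (simp add: space_prob_algebra)
      \<comment> \<open>\<open>ennreal\<close> is additive only on nonnegative reals, hence the
        appeal to \<open>tv_dist_nonneg\<close>.\<close>
      finally have "ennreal (tv_dist (bind (bind ?Q T) K) ?P)
          \<le> ennreal (tv_dist (bind ?P T) (bind ?Q T)) + ennreal (tv_dist (bind (bind ?P T) K) ?P)"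
        using PT QT probs pP
        by (subst ennreal_plus[symmetric]) (auto simp: space_prob_algebra intro!: tv_dist_nonneg ennreal_leI)
      also have "\<dots> \<le> ?s + ?g K"
        using \<theta> par by (intro add_mono SUP_upper) auto
      finally show ?thesis unfolding assoc .
    qed
    then show ?thesis
      unfolding deficiency_def by (intro INF_lower2[OF TK] SUP_least)
  qed
  have "deficiency (experiment_comp ES Z T) ES = (INF K \<in> Z \<rightarrow>\<^sub>M prob_algebra ?X. ?g K)"
    by (simp add: deficiency_def experiment_comp_def)
  moreover have "deficiency ET ES \<le> ?s + (INF K \<in> Z \<rightarrow>\<^sub>M prob_algebra ?X. ?g K)"
  \<comment> \<open>The constant \<open>?s\<close> is moved across the infimum by subtracting it.
    Since \<open>top - top = top\<close> in \<open>ennreal\<close>, the equivalence used for this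
    has a side condition at infinity, and the case of infinite \<open>?s\<close> is split
    off.\<close>
  proof (cases "?s = top")
    case False
    then have "deficiency ET ES - ?s \<le> ?g K" if "K \<in> Z \<rightarrow>\<^sub>M prob_algebra ?X" for K
      using bound[OF that] by (simp only: ennreal_minus_le_iff) simp
    then have "deficiency ET ES - ?s \<le> (INF K \<in> Z \<rightarrow>\<^sub>M prob_algebra ?X. ?g K)"
      by (rule INF_greatest)
    then show ?thesis by (simp only: ennreal_minus_le_iff)
  next
    case True
    show ?thesis unfolding True by simp
  qed
  ultimately show ?thesis by (simp add: add.commute)
qed

theorem theorem5p1:
  "\<exists>C::real. C > 0 \<and>
    (\<forall>(ES :: ('x, 't) stat_exp) (ET :: ('x, 't) stat_exp)
       (Z :: 'z measure) (T :: 'x \<Rightarrow> 'z measure).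
       statistical_experiment ES \<and> statistical_experiment ET \<and>
       param_set ES = param_set ET \<and>
       sets (sample_space ES) = sets (sample_space ET) \<and>
       T \<in> sample_space ES \<rightarrow>\<^sub>M prob_algebra Z \<longrightarrow>
       deficiency (experiment_comp ES Z T) ES
         + deficiency (experiment_comp ET Z T) ET
         + (SUP \<theta>\<in>param_set ES. ennreal (tv_dist (bind (law ES \<theta>) T) (bind (law ET \<theta>) T)))
       \<ge> ennreal C * deficiency ET ES)"
proof (intro exI[of _ 1] conjI allI impI)
  fix ES ET :: "('x, 't) stat_exp" and Z :: "'z measure" and T :: "'x \<Rightarrow> 'z measure"
  assume "statistical_experiment ES \<and> statistical_experiment ET \<and>
    param_set ES = param_set ET \<and> sets (sample_space ES) = sets (sample_space ET) \<and>
    T \<in> sample_space ES \<rightarrow>\<^sub>M prob_algebra Z"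
  then have "deficiency ET ES \<le> deficiency (experiment_comp ES Z T) ES
     + (SUP \<theta>\<in>param_set ES. ennreal (tv_dist (bind (law ES \<theta>) T) (bind (law ET \<theta>) T)))"
    (is "_ \<le> ?a + ?s")
    by (intro deficiency_le_representation) auto
  \<comment> \<open>Deficiencies are nonnegative by their type, so inserting that of the target only
    enlarges the bound.\<close>
  also have "\<dots> \<le> ?a + deficiency (experiment_comp ET Z T) ET + ?s"
    by (intro add_right_mono) simp
  finally show "ennreal 1 * deficiency ET ES \<le> ?a + deficiency (experiment_comp ET Z T) ET + ?s"
    by simp
qed simp

end
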